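(* Let $a$ be a real number with $a\ne -1,-2,\dots$ and let $s\in\mathbb{N}$, $s\ge2$. Then \begin{align*} \sum_{n=1}^\infty\frac{H_n^3-3H_n\zeta_n(2)}{(n+a)^s} &=s\sum_{n=1}^\infty\frac{H_n^2}{(n+a)^{s+1}}-\sum_{j=2}^{s-1}\left(\sum_{n=1}^\infty\frac{H_n}{(n+a)^j}\right)\left(\sum_{n=1}^\infty\frac{H_n}{(n+a)^{s+1-j}}\right)\\ &\quad+2a\left(\sum_{n=1}^\infty\frac{H_n}{(n+a)^s}\right)\left(\sum_{n=1}^\infty\frac{H_n}{n(n+a)}\right). \end{align*}
   Context: $H_n=\sum_{j=1}^n\frac1j$ and $\zeta_n(2)=\sum_{j=1}^n\frac1{j^2}$. Empty sums are zero. *)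

theory Defs
  imports "HOL-Analysis.Analysis"
begin

text \<open>The harmonic numbers are the library's \<^const>\<open>harm\<close>, whose sum also starts at index 1.\<close>

definition zeta2_partial :: "nat \<Rightarrow> real" where
  "zeta2_partial n = (\<Sum>j=1..n. 1 / (real j)^2)"

end

theory Submission
  imports Defs "HOL-Real_Asymp.Real_Asymp"
begin

text \<open>
  Write \<open>h\<^sub>n\<close> for the harmonic numbers and \<open>u\<^sub>n = 1 / (n + a)\<close>. Off the diagonal, the geometric sum
  \<open>\<Sum>j=2..s-1. u\<^sub>n^j u\<^sub>m^(s+1-j)\<close> equals \<open>(u\<^sub>n^(s-1) u\<^sub>m - u\<^sub>m^(s-1) u\<^sub>n) / (m - n)\<close>. Hence the sum of
  products of linear series is twice the double series of
  \<open>F n m = h\<^sub>n h\<^sub>m u\<^sub>n^(s-1) u\<^sub>m / (m - n)\<close>, up to the diagonal part \<open>(s - 2) \<Sum>n. h\<^sub>n^2 u\<^sub>n^(s+1)\<close>.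
  This double series converges absolutely (also for \<open>s = 2\<close>, where it vanishes by antisymmetry),
  so it can be summed over \<open>m\<close> first. Since
  \<open>u\<^sub>m / (m - n) = u\<^sub>n ((1 / (m - n) - 1 / m) + a / (m (m + a)))\<close>, what remains is the evaluation
  of \<open>\<Sum>m\<noteq>n. h\<^sub>m (1 / (m - n) - 1 / m)\<close>: the tail \<open>m > n\<close> satisfies a first-order recurrence in \<open>n\<close>,
  and the head \<open>m < n\<close> is a convolution of harmonic numbers.
\<close>

section \<open>Series and finite sums of harmonic numbers\<close>

lemma harm_over_n_tendsto_0: "(\<lambda>n. harm n / real n) \<longlonglongrightarrow> 0"
proof -
  have "(\<lambda>n. (harm n - ln (real n)) * (1 / real n) + ln (real n) / real n) \<longlonglongrightarrow> euler_mascheroni * 0 + 0"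
    by (intro tendsto_intros euler_mascheroni_LIMSEQ; real_asymp)
  thus ?thesis by (simp add: diff_divide_distrib)
qed

lemma zeta2_partial_Suc: "zeta2_partial (Suc n) = zeta2_partial n + 1 / (real (Suc n))\<^sup>2"
  by (simp add: zeta2_partial_def)

text \<open>Raising \<open>n\<close> by one adds a telescoping series with sum
  \<open>1 / real (Suc n)\<close>.\<close>

lemma sums_inverse_diff_harm:
  "(\<lambda>k. 1 / real (Suc k) - 1 / real (Suc k + n)) sums harm n"
proof (induction n)
  case (Suc n)
  have "(\<lambda>k. 1 / real (Suc k + n)) \<longlonglongrightarrow> 0"
    by real_asymp
  from sums_add[OF Suc telescope_sums'[OF this]] show ?case
    by (simp add: harm_Suc inverse_eq_divide add_ac)
qed (simp add: harm_def)

lemma sums_inverse_product_harm: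
  "(\<lambda>k. 1 / (real (Suc k) * real (Suc k + Suc n))) sums (harm (Suc n) / real (Suc n))"
proof -
  have "(\<lambda>k. (1 / real (Suc k) - 1 / real (Suc k + Suc n)) / real (Suc n)) =
      (\<lambda>k. 1 / (real (Suc k) * real (Suc k + Suc n)))"
    by (rule ext) (simp add: divide_simps)
  thus ?thesis
    using sums_divide[OF sums_inverse_diff_harm[of "Suc n"], of "real (Suc n)"] by (simp only:)
qed

text \<open>Taken at \<open>Suc n\<close>, this is the tail \<open>m > n\<close> of the kernel
  series below. In the step from \<open>n\<close> to \<open>Suc n\<close> the terms change by a
  telescoping difference of \<open>?g\<close> and by a product of reciprocals; each of these two
  series contributes \<open>harm (Suc n) / real (Suc n)\<close>.\<close>

lemma sums_harm_shifted:
  "(\<lambda>k. harm (Suc k + n) * (1 / real (Suc k) - 1 / real (Suc k + n))) sums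
    ((harm n)\<^sup>2 + zeta2_partial n)"
proof (induction n)
  case (Suc n)
  let ?g = "\<lambda>k. harm (Suc k + n) / real (Suc k + n)"
  have "(\<lambda>k. harm (k + Suc n) / real (k + Suc n)) \<longlonglongrightarrow> 0"
    by (rule LIMSEQ_ignore_initial_segment[OF harm_over_n_tendsto_0])
  hence "?g \<longlonglongrightarrow> 0" by simp
  from sums_add[OF sums_add[OF Suc telescope_sums'[OF this]] sums_inverse_product_harm[of n]]
  have "(\<lambda>k. harm (Suc k + n) * (1 / real (Suc k) - 1 / real (Suc k + n)) + (?g k - ?g (Suc k))
        + 1 / (real (Suc k) * real (Suc k + Suc n))) sums
      ((harm n)\<^sup>2 + zeta2_partial n + (?g 0 - 0) + harm (Suc n) / real (Suc n))"
    by simp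
  also have "(\<lambda>k. harm (Suc k + n) * (1 / real (Suc k) - 1 / real (Suc k + n)) + (?g k - ?g (Suc k))
        + 1 / (real (Suc k) * real (Suc k + Suc n))) =
      (\<lambda>k. harm (Suc k + Suc n) * (1 / real (Suc k) - 1 / real (Suc k + Suc n)))"
  proof
    fix k
    have h: "harm (Suc k + Suc n) = harm (Suc k + n) + 1 / real (Suc k + Suc n)"
      using harm_Suc[of "Suc k + n", where 'a = real] by (simp add: inverse_eq_divide)
    show "harm (Suc k + n) * (1 / real (Suc k) - 1 / real (Suc k + n)) + (?g k - ?g (Suc k))
        + 1 / (real (Suc k) * real (Suc k + Suc n)) =
      harm (Suc k + Suc n) * (1 / real (Suc k) - 1 / real (Suc k + Suc n))"
      unfolding h by (simp add: h[simplified] algebra_simps add_divide_distrib)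
  qed
  also have "(harm n)\<^sup>2 + zeta2_partial n + (?g 0 - 0) + harm (Suc n) / real (Suc n) =
      (harm (Suc n))\<^sup>2 + zeta2_partial (Suc n)"
    by (simp add: zeta2_partial_Suc harm_Suc power2_eq_square divide_inverse algebra_simps
          del: of_nat_Suc)
  finally show ?case .
qed (simp add: harm_def zeta2_partial_def)

text \<open>Expanding the harmonic numbers gives the sum of \<open>1 / (i * j)\<close> over
  \<open>j \<le> i \<le> n\<close>: by symmetry, half of the full square plus half of the
  diagonal.\<close>

lemma sum_harm_over_n:
  "(\<Sum>m<n. harm (Suc m) / real (Suc m)) = ((harm n)\<^sup>2 + zeta2_partial n) / 2"
proof (induction n)
  case (Suc n)
  have "(x\<^sup>2 + y) / 2 + (x + r) * r = ((x + r)\<^sup>2 + (y + r\<^sup>2)) / 2" for x y r :: real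
    by (simp add: power2_eq_square algebra_simps)
  from this[of "harm n" "zeta2_partial n" "inverse (real (Suc n))"] show ?case
    unfolding sum.lessThan_Suc Suc harm_Suc[of n] zeta2_partial_Suc[of n]
    by (simp only: divide_inverse mult_1_left power_inverse)
qed (simp add: harm_def zeta2_partial_def)

lemma sum_inverse_reflected: "(\<Sum>m<n. 1 / (real n - real m)) = harm n"
proof -
  have "(\<Sum>m<n. 1 / (real n - real m)) = (\<Sum>m<n. 1 / (real n - real (n - Suc m)))"
    by (rule sum.nat_diff_reindex[symmetric])
  also have "\<dots> = harm n"
    unfolding harm_altdef by (intro sum.cong) (auto simp: of_nat_diff inverse_eq_divide)
  finally show ?thesis .
qed

text \<open>In the induction step, shifting the index turns \<open>harm (Suc m)\<close> into
  \<open>harm (Suc (Suc m))\<close>. The extra reciprocal splits by partial fractions because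
  \<open>(n - m) + (m + 2)\<close> does not depend on \<open>m\<close>, which leaves only harmonic
  sums.\<close>

lemma sum_harm_convolution:
  "(\<Sum>m<n. harm (Suc m) / (real n - real m)) = (harm (Suc n))\<^sup>2 - zeta2_partial (Suc n)"
proof (induction n)
  case (Suc n)
  have split: "harm (Suc (Suc m)) / (real n - real m) = harm (Suc m) / (real n - real m)
      + (1 / real (Suc (Suc m)) + 1 / (real n - real m)) / real (Suc (Suc n))" if "m < n" for m
  proof -
    have "real n - real m \<noteq> 0" using that by simp
    moreover have "real (Suc (Suc n)) = (real n - real m) + real (Suc (Suc m))" by simp
    ultimately have "1 / real (Suc (Suc m)) / (real n - real m) =
        (1 / real (Suc (Suc m)) + 1 / (real n - real m)) / real (Suc (Suc n))"
      by (simp add: divide_simps)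
    thus ?thesis
      unfolding harm_Suc[of "Suc m"] by (simp add: add_divide_distrib inverse_eq_divide)
  qed
  have shifted: "(\<Sum>m<n. 1 / real (Suc (Suc m))) = harm (Suc n) - 1"
    unfolding harm_altdef by (subst sum.lessThan_Suc_shift) (simp add: inverse_eq_divide)
  have "(\<Sum>m<Suc n. harm (Suc m) / (real (Suc n) - real m)) =
      1 / real (Suc n) + (\<Sum>m<n. harm (Suc (Suc m)) / (real n - real m))"
    by (subst sum.lessThan_Suc_shift) (simp add: harm_expand)
  also have "(\<Sum>m<n. harm (Suc (Suc m)) / (real n - real m)) =
      (\<Sum>m<n. harm (Suc m) / (real n - real m)
         + (1 / real (Suc (Suc m)) + 1 / (real n - real m)) / real (Suc (Suc n)))"
    by (intro sum.cong refl split) auto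
  also have "\<dots> = (harm (Suc n))\<^sup>2 - zeta2_partial (Suc n)
      + (harm (Suc n) - 1 + harm n) / real (Suc (Suc n))"
    by (simp only: sum.distrib Suc sum_divide_distrib[symmetric] shifted sum_inverse_reflected)
  also have "harm n = harm (Suc n) - 1 / real (Suc n)"
    by (simp add: harm_Suc inverse_eq_divide)
  also have "1 / real (Suc n) + ((harm (Suc n))\<^sup>2 - zeta2_partial (Suc n)
      + (harm (Suc n) - 1 + (harm (Suc n) - 1 / real (Suc n))) / real (Suc (Suc n))) =
      (harm (Suc (Suc n)))\<^sup>2 - zeta2_partial (Suc (Suc n))"
    unfolding harm_Suc[of "Suc n"] zeta2_partial_Suc[of "Suc n"]
    by (simp add: power2_eq_square divide_simps del: of_nat_Suc)
       (simp add: algebra_simps)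
  finally show ?case .
qed (simp add: harm_expand zeta2_partial_def)

text \<open>The term \<open>m = n\<close> contributes \<open>- harm (Suc n) / real (Suc n)\<close>, since \<open>1 / 0 = 0\<close>.\<close>
lemma sums_harm_kernel:
  "(\<lambda>m. harm (Suc m) * (1 / (real m - real n) - 1 / real (Suc m))) sums
    ((3 * zeta2_partial (Suc n) - (harm (Suc n))\<^sup>2) / 2)"
proof -
  let ?f = "\<lambda>m. harm (Suc m) * (1 / (real m - real n) - 1 / real (Suc m)) :: real"
  have "(\<lambda>k. ?f (k + Suc n)) sums ((harm (Suc n))\<^sup>2 + zeta2_partial (Suc n))"
  proof -
    have "?f (k + Suc n) = harm (Suc k + Suc n) * (1 / real (Suc k) - 1 / real (Suc k + Suc n))" for k
    proof -
      have "real (k + Suc n) - real n = real (Suc k)" "Suc (k + Suc n) = Suc k + Suc n" by simp_all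
      thus ?thesis by (simp only:)
    qed
    thus ?thesis
      using sums_harm_shifted[of "Suc n"] by (simp only:)
  qed
  hence "?f sums ((harm (Suc n))\<^sup>2 + zeta2_partial (Suc n) + (\<Sum>m<Suc n. ?f m))"
    by (rule iffD1[OF sums_iff_shift])
  moreover have "(\<Sum>m<Suc n. ?f m) =
      - (\<Sum>m<Suc n. harm (Suc m) / (real n - real m)) - (\<Sum>m<Suc n. harm (Suc m) / real (Suc m))"
    unfolding sum_negf[symmetric] sum_subtractf[symmetric]
  proof (intro sum.cong refl)
    fix m
    have "1 / (real m - real n) = - (1 / (real n - real m))"
      by (metis minus_diff_eq minus_divide_right)
    thus "?f m = - (harm (Suc m) / (real n - real m)) - harm (Suc m) / real (Suc m)"
      by (simp add: algebra_simps)
  qed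
  \<comment> \<open>The term \<open>m = n\<close> is a division by zero, hence 0, so the range may
    be cut to \<open>m < n\<close> before the convolution formula is applied.\<close>
  moreover have "(\<Sum>m<Suc n. harm (Suc m) / (real n - real m)) =
      (harm (Suc n))\<^sup>2 - zeta2_partial (Suc n)"
    using sum_harm_convolution[of n] by simp
  ultimately have "?f sums ((harm (Suc n))\<^sup>2 + zeta2_partial (Suc n)
      + (- ((harm (Suc n))\<^sup>2 - zeta2_partial (Suc n))
         - ((harm (Suc n))\<^sup>2 + zeta2_partial (Suc n)) / 2))"
    by (simp only: sum_harm_over_n)
  also have "(harm (Suc n))\<^sup>2 + zeta2_partial (Suc n)
      + (- ((harm (Suc n))\<^sup>2 - zeta2_partial (Suc n))
         - ((harm (Suc n))\<^sup>2 + zeta2_partial (Suc n)) / 2) =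
      (3 * zeta2_partial (Suc n) - (harm (Suc n))\<^sup>2) / 2"
    by (simp add: field_simps)
  finally show ?thesis .
qed

section \<open>Growth bounds and absolute convergence\<close>

lemma harm_Suc_ge_1: "1 \<le> (harm (Suc n) :: real)"
  using harm_mono[of 1 "Suc n", where 'a = real] by (simp add: harm_expand)

lemma zeta2_partial_nonneg: "0 \<le> zeta2_partial n"
  unfolding zeta2_partial_def by (intro sum_nonneg) simp

lemma zeta2_partial_le_harm: "zeta2_partial n \<le> harm n"
  unfolding zeta2_partial_def harm_def
  by (intro sum_mono) (auto simp: power2_eq_square divide_simps)

lemma harm_Suc_power_le_cube:
  assumes "p \<le> 3"
  shows "harm (Suc n) ^ p \<le> (harm (Suc n) :: real) ^ 3"
  using assms harm_Suc_ge_1 by (rule power_increasing)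

text \<open>Harmonic numbers grow logarithmically, so the exponent \<open>-3/2\<close> leaves room
  for the cube. This series serves as majorant for all the single series of the theorem and for the
  row sums of the double series.\<close>

lemma summable_harm_cube_over_square:
  "summable (\<lambda>n. harm (Suc n) ^ 3 / (real (Suc n))\<^sup>2)"
proof -
  have "summable (\<lambda>n. harm n ^ 3 / (real n)\<^sup>2 :: real)"
  proof (rule summable_comparison_test_ev)
    show "summable (\<lambda>n. real n powr (-3/2))"
      by (subst summable_real_powr_iff) simp
    have "\<forall>\<^sub>F n in sequentially. (1 + ln (real n)) ^ 3 / (real n)\<^sup>2 \<le> real n powr (-3/2)"
      by real_asymp
    thus "\<forall>\<^sub>F n in sequentially. norm (harm n ^ 3 / (real n)\<^sup>2) \<le> real n powr (-3/2)"
      using eventually_gt_at_top[of 0]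
    proof eventually_elim
      case (elim n)
      hence "harm n \<le> 1 + ln (real n)"
        using euler_mascheroni_sequence_decreasing[of 1 n] by (simp add: harm_expand)
      hence "harm n ^ 3 / (real n)\<^sup>2 \<le> (1 + ln (real n)) ^ 3 / (real n)\<^sup>2"
        by (intro divide_right_mono power_mono) (auto intro: harm_nonneg)
      thus ?case using elim(1) by (simp add: harm_nonneg)
    qed
  qed
  thus ?thesis by (subst summable_Suc_iff)
qed

text \<open>Up to a constant this majorises the double series \<open>F\<close> of the main proof.
  The weight is symmetric, so it suffices to sum below the diagonal, where the row sums are bounded
  by a multiple of the previous majorant.\<close>

lemma summable_on_harm_product_kernel:
  "(\<lambda>(n, m). harm (Suc n) * harm (Suc m) / (real (Suc n) * real (Suc m) * \<bar>real m - real n\<bar>))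
    summable_on (UNIV :: (nat \<times> nat) set)" (is "?w summable_on _")
proof -
  define inner where "inner m = (\<Sum>n<m. ?w (m, n))" for m
  have inner_nonneg: "0 \<le> inner m" for m
    unfolding inner_def by (auto intro!: sum_nonneg mult_nonneg_nonneg divide_nonneg_nonneg harm_nonneg)
  have inner_le: "inner m \<le> 2 * (harm (Suc m) ^ 3 / (real (Suc m))\<^sup>2)" for m
  proof -
    \<comment> \<open>partial fractions, after \<open>h\<^sub>n \<le> h\<^sub>m\<close>: both resulting sums are at most \<open>h\<^sub>m\<close>\<close>
    have "inner m \<le> (\<Sum>n<m. (harm (Suc m) / real (Suc m))\<^sup>2 * (1 / real (Suc n) + 1 / (real m - real n)))"
      unfolding inner_def
    proof (rule sum_mono)
      fix n assume "n \<in> {..<m}"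
      hence nm: "n < m" by simp
      have "?w (m, n) = harm (Suc m) * harm (Suc n) / (real (Suc m) * real (Suc n) * (real m - real n))"
        using nm by simp
      also have "\<dots> \<le> harm (Suc m) * harm (Suc m) / (real (Suc m) * real (Suc n) * (real m - real n))"
        using nm by (intro divide_right_mono mult_left_mono harm_mono harm_nonneg) auto
      also have "\<dots> = (harm (Suc m) / real (Suc m))\<^sup>2 * (1 / real (Suc n) + 1 / (real m - real n))"
      proof -
        have "real (Suc m) = real (Suc n) + (real m - real n)" "real m - real n > 0"
          using nm by auto
        hence "1 / (real (Suc n) * (real m - real n)) =
            (1 / real (Suc n) + 1 / (real m - real n)) / real (Suc m)"
          by (simp add: divide_simps)
        hence "harm (Suc m) * harm (Suc m) / real (Suc m) * (1 / (real (Suc n) * (real m - real n))) =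
            harm (Suc m) * harm (Suc m) / real (Suc m) *
            ((1 / real (Suc n) + 1 / (real m - real n)) / real (Suc m))"
          by (simp only:)
        thus ?thesis
          by (simp only: power2_eq_square times_divide_eq_left times_divide_eq_right times_divide_times_eq divide_divide_eq_left mult_1_right mult.assoc)
      qed
      finally show "?w (m, n) \<le> \<dots>" .
    qed
    also have "\<dots> = (harm (Suc m) / real (Suc m))\<^sup>2 * (harm m + harm m)"
      unfolding sum_distrib_left[symmetric] sum.distrib sum_inverse_reflected
      by (simp add: harm_altdef inverse_eq_divide)
    also have "\<dots> \<le> (harm (Suc m) / real (Suc m))\<^sup>2 * (harm (Suc m) + harm (Suc m))"
      by (intro mult_left_mono add_mono harm_mono) auto
    also have "\<dots> = 2 * (harm (Suc m) ^ 3 / (real (Suc m))\<^sup>2)"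
      by (simp add: power2_eq_square power3_eq_cube)
    finally show ?thesis .
  qed
  have "?w summable_on (SIGMA m:UNIV. {..<m})"
  proof (rule summable_on_SigmaI)
    show "((\<lambda>n. ?w (m, n)) has_sum inner m) {..<m}" for m
      unfolding inner_def by (rule has_sum_finite) simp
    have "summable inner"
      by (rule summable_comparison_test'[OF summable_mult[OF summable_harm_cube_over_square, of 2]])
         (use inner_nonneg inner_le in simp)
    thus "inner summable_on UNIV"
      by (intro summable_nonneg_imp_summable_on inner_nonneg)
  qed (auto intro!: mult_nonneg_nonneg divide_nonneg_nonneg harm_nonneg)
  hence lower: "(\<lambda>(m, n). if n < m then ?w (m, n) else 0) summable_on UNIV \<times> UNIV"
    by (rule summable_on_cong_neutral[THEN iffD1, rotated -1]) (auto split: if_splits)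
  \<comment> \<open>The lower triangle and its mirror image make up the whole weight; on the
    diagonal it is 0 because of \<open>x / 0 = 0\<close>.\<close>
  from summable_on_add[OF lower lower[THEN summable_on_swap[THEN iffD1]]]
  show ?thesis
    unfolding UNIV_Times_UNIV
    by (rule summable_on_cong[THEN iffD1, rotated])
       (auto simp: abs_minus_commute mult_ac not_less)
qed

text \<open>The ratio of \<open>n + 1\<close> to \<open>n + 1 + a\<close> converges to 1, hence is
  bounded; \<open>K\<close> is such a bound.\<close>

lemma inverse_shift_bound:
  fixes a :: real
  assumes "\<forall>k\<ge>1. a \<noteq> - real k"
  obtains K where "K > 0" "\<And>n. \<bar>1 / (real (Suc n) + a)\<bar> \<le> K / real (Suc n)"
proof -
  have "(\<lambda>n. real (Suc n) / (real (Suc n) + a)) \<longlonglongrightarrow> 1"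
    by real_asymp
  hence "Bseq (\<lambda>n. real (Suc n) / (real (Suc n) + a))"
    by (intro convergent_imp_Bseq convergentI)
  then obtain K where K: "K > 0" "\<And>n. norm (real (Suc n) / (real (Suc n) + a)) \<le> K"
    by (auto elim: BseqE)
  have "\<bar>1 / (real (Suc n) + a)\<bar> \<le> K / real (Suc n)" for n
    using K(2)[of n] by (simp add: abs_divide field_simps)
  with K(1) show thesis by (rule that)
qed

section \<open>Unconditional sums over product sets, and a geometric sum\<close>

lemma has_sum_times:
  fixes f g :: "_ \<Rightarrow> real"
  assumes f: "(f has_sum S) A" and g: "(g has_sum T) B"
  shows "((\<lambda>(x, y). f x * g y) has_sum (S * T)) (A \<times> B)"
proof (rule has_sum_SigmaI)
  show "((\<lambda>y. case (x, y) of (x, y) \<Rightarrow> f x * g y) has_sum (f x * T)) B" for x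
    using has_sum_cmult_right[OF g, of "f x"] by simp
  show "((\<lambda>x. f x * T) has_sum (S * T)) A"
    using has_sum_cmult_left[OF f] .
  have "f summable_on A" "g summable_on B"
    using f g by (auto simp: summable_on_def)
  note abs_summable = this[THEN summable_on_iff_abs_summable_on_real[THEN iffD1], unfolded real_norm_def]
  have "(\<lambda>(x, y). \<bar>f x\<bar> * \<bar>g y\<bar>) summable_on A \<times> B"
  proof (rule summable_on_SigmaI)
    show "((\<lambda>y. case (x, y) of (x, y) \<Rightarrow> \<bar>f x\<bar> * \<bar>g y\<bar>) has_sum
        (\<bar>f x\<bar> * (\<Sum>\<^sub>\<infinity>y\<in>B. \<bar>g y\<bar>))) B" for x
      using has_sum_cmult_right[OF has_sum_infsum[OF abs_summable(2)], of "\<bar>f x\<bar>"] by simp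
    show "(\<lambda>x. \<bar>f x\<bar> * (\<Sum>\<^sub>\<infinity>y\<in>B. \<bar>g y\<bar>)) summable_on A"
      using abs_summable(1) by (rule summable_on_cmult_left)
  qed auto
  thus "(\<lambda>(x, y). f x * g y) summable_on A \<times> B"
    by (subst summable_on_iff_abs_summable_on_real) (simp add: case_prod_unfold abs_mult)
qed

lemma has_sum_diagonal:
  assumes "(f has_sum S) A"
  shows "((\<lambda>(x, y). if x = y then f x else 0) has_sum S) (A \<times> A)"
proof -
  have "((\<lambda>(x, y). if x = y then f x else 0) has_sum S) ((\<lambda>x. (x, x)) ` A)"
    by (subst has_sum_reindex) (use assms in \<open>auto simp: o_def inj_on_def\<close>)
  also have "?this \<longleftrightarrow> ?thesis"
    by (rule has_sum_cong_neutral) auto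
  finally show ?thesis .
qed

lemma has_sum_sum:
  fixes f :: "'i \<Rightarrow> 'a \<Rightarrow> 'b :: topological_comm_monoid_add"
  assumes "\<And>i. i \<in> I \<Longrightarrow> (f i has_sum S i) A"
  shows "((\<lambda>x. \<Sum>i\<in>I. f i x) has_sum (\<Sum>i\<in>I. S i)) A"
  using assms
proof (induction I rule: infinite_finite_induct)
  case (insert i I)
  thus ?case by (simp add: has_sum_add)
qed auto

text \<open>The geometric sum in division-free form, so that it can be proved by induction in any
  commutative ring. It is applied with \<open>r = s - 2\<close>, where \<open>Suc r = s - 1\<close>
  and \<open>r + 3 = s + 1\<close>.\<close>

lemma sum_geometric_mixed:
  fixes x y :: "'a :: comm_ring_1"
  shows "(x - y) * (\<Sum>j=2..Suc r. x ^ j * y ^ (r + 3 - j)) = x\<^sup>2 * y\<^sup>2 * (x ^ r - y ^ r)"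
proof (induction r)
  case (Suc r)
  have "(\<Sum>j=2..Suc (Suc r). x ^ j * y ^ (Suc r + 3 - j)) =
      (\<Sum>j=2..Suc r. y * (x ^ j * y ^ (r + 3 - j))) + x ^ (r + 2) * y\<^sup>2"
  proof -
    have "x ^ j * y ^ (Suc r + 3 - j) = y * (x ^ j * y ^ (r + 3 - j))" if "j \<in> {2..Suc r}" for j
    proof -
      have "Suc r + 3 - j = Suc (r + 3 - j)" using that by (auto simp: Suc_diff_le)
      thus ?thesis by (simp only: power_Suc mult.left_commute)
    qed
    hence "(\<Sum>j=2..Suc r. x ^ j * y ^ (Suc r + 3 - j)) =
        (\<Sum>j=2..Suc r. y * (x ^ j * y ^ (r + 3 - j)))"
      by (rule sum.cong[OF refl])
    thus ?thesis by (subst sum.cl_ivl_Suc) simp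
  qed
  hence "(x - y) * (\<Sum>j=2..Suc (Suc r). x ^ j * y ^ (Suc r + 3 - j)) =
      y * ((x - y) * (\<Sum>j=2..Suc r. x ^ j * y ^ (r + 3 - j))) + (x - y) * (x ^ (r + 2) * y\<^sup>2)"
    by (simp only: sum_distrib_left[symmetric] distrib_left mult.left_commute)
  thus ?case
    unfolding Suc by (simp add: algebra_simps power2_eq_square)
qed simp

section \<open>Evaluating the double series in two ways\<close>

theorem theorem3p2:
  fixes a :: real and s :: nat
  assumes a: "\<forall>k\<ge>1. a \<noteq> - real k"
    and s: "s \<ge> 2"
  shows "summable (\<lambda>n. (harm (Suc n) ^ 3 - 3 * harm (Suc n) * zeta2_partial (Suc n)) / (real (Suc n) + a) ^ s)
    \<and> summable (\<lambda>n. (harm (Suc n))\<^sup>2 / (real (Suc n) + a) ^ (s + 1))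
    \<and> (\<forall>j\<in>{2..s}. summable (\<lambda>n. harm (Suc n) / (real (Suc n) + a) ^ j))
    \<and> summable (\<lambda>n. harm (Suc n) / (real (Suc n) * (real (Suc n) + a)))
    \<and> (\<Sum>n. (harm (Suc n) ^ 3 - 3 * harm (Suc n) * zeta2_partial (Suc n)) / (real (Suc n) + a) ^ s)
      = real s * (\<Sum>n. (harm (Suc n))\<^sup>2 / (real (Suc n) + a) ^ (s + 1))
        - (\<Sum>j=2..s-1. (\<Sum>n. harm (Suc n) / (real (Suc n) + a) ^ j)
                        * (\<Sum>n. harm (Suc n) / (real (Suc n) + a) ^ (s + 1 - j)))
        + 2 * a * (\<Sum>n. harm (Suc n) / (real (Suc n) + a) ^ s)
                * (\<Sum>n. harm (Suc n) / (real (Suc n) * (real (Suc n) + a)))"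
proof -
  \<comment> \<open>Indices start at 0 here, so \<open>n\<close> stands for the summation index
    \<open>n + 1\<close>; differences \<open>m - n\<close> are unaffected.\<close>
  define h :: "nat \<Rightarrow> real" where "h n = harm (Suc n)" for n
  define z where "z n = zeta2_partial (Suc n)" for n
  define u where "u n = 1 / (real (Suc n) + a)" for n
  have shift_nz: "real (Suc n) + a \<noteq> 0" for n
    using a[rule_format, of "Suc n"] by linarith
  have u_nz: "u n \<noteq> 0" for n
    using shift_nz[of n] by (simp add: u_def)
  have div_u: "x / (real (Suc n) + a) ^ p = x * u n ^ p" for x n p
    by (simp add: u_def power_one_over)
  obtain K where K: "K > 0" "\<And>n. \<bar>u n\<bar> \<le> K / real (Suc n)"
    using inverse_shift_bound[OF a] unfolding u_def by blast
  have u_power_le: "\<bar>u n\<bar> ^ p \<le> K ^ p / real (Suc n) ^ q" if "q \<le> p" for n p q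
  proof -
    have "\<bar>u n\<bar> ^ p \<le> (K / real (Suc n)) ^ p"
      using K by (intro power_mono) auto
    also have "\<dots> \<le> K ^ p / real (Suc n) ^ q"
      unfolding power_divide using K that by (intro divide_left_mono power_increasing) auto
    finally show ?thesis .
  qed
  have h_ge_1: "1 \<le> h n" for n
    unfolding h_def by (rule harm_Suc_ge_1)
  have h_cube: "h n ^ p \<le> h n ^ 3" if "p \<le> 3" for n p
    unfolding h_def using that by (rule harm_Suc_power_le_cube)
  \<comment> \<open>The bound \<open>3 * h n ^ 3\<close> covers every numerator over a power of
    \<open>n + a\<close>: \<open>h n\<close> and its square are at most the cube, and
    \<open>0 \<le> h n * z n \<le> h n ^ 3\<close> controls the combination with
    \<open>z n\<close>.\<close>
  have summable_weighted: "summable (\<lambda>n. norm (c n * u n ^ p))"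
    if "p \<ge> 2" and "\<And>n. \<bar>c n\<bar> \<le> 3 * h n ^ 3" for c p
  proof (rule summable_comparison_test')
    show "summable (\<lambda>n. 3 * K ^ p * (h n ^ 3 / (real (Suc n))\<^sup>2))"
      unfolding h_def by (intro summable_mult summable_harm_cube_over_square)
    fix n
    have "\<bar>c n\<bar> * \<bar>u n\<bar> ^ p \<le> 3 * h n ^ 3 * (K ^ p / (real (Suc n))\<^sup>2)"
      using that h_ge_1[of n] by (intro mult_mono u_power_le) auto
    thus "norm (norm (c n * u n ^ p)) \<le> 3 * K ^ p * (h n ^ 3 / (real (Suc n))\<^sup>2)"
      by (simp add: abs_mult power_abs mult_ac)
  qed
  have has_sum_weighted: "((\<lambda>n. c n * u n ^ p) has_sum (\<Sum>n. c n * u n ^ p)) UNIV"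
    if "p \<ge> 2" and "\<And>n. \<bar>c n\<bar> \<le> 3 * h n ^ 3" for c p
    by (intro norm_summable_imp_has_sum summable_weighted that
          summable_sums[OF summable_norm_cancel[OF summable_weighted]])

  have cube_bound: "\<bar>h n ^ 3 - 3 * h n * z n\<bar> \<le> 3 * h n ^ 3" for n
  proof -
    have "z n \<le> h n ^ 2"
      using zeta2_partial_le_harm[of "Suc n"] self_le_power[OF h_ge_1[of n], of 2]
      by (simp add: z_def h_def)
    hence "h n * z n \<le> h n * h n ^ 2" "0 \<le> h n * z n"
      using h_ge_1[of n] zeta2_partial_nonneg[of "Suc n"] by (auto intro: mult_left_mono simp: z_def)
    moreover have "h n ^ 3 = h n * h n ^ 2" by (simp add: power3_eq_cube power2_eq_square)
    ultimately show ?thesis by linarith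
  qed
  have square_bound: "\<bar>(h n)\<^sup>2\<bar> \<le> 3 * h n ^ 3" for n
    using h_cube[of 2 n] one_le_power[OF h_ge_1, of n 3] by simp
  have linear_bound: "\<bar>h n\<bar> \<le> 3 * h n ^ 3" for n
    using h_cube[of 1 n] h_ge_1[of n] by simp

  define L where "L = (\<Sum>n. (h n ^ 3 - 3 * h n * z n) * u n ^ s)"
  define Q where "Q = (\<Sum>n. (h n)\<^sup>2 * u n ^ (s + 1))"
  define S where "S p = (\<Sum>n. h n * u n ^ p)" for p
  define B where "B = (\<Sum>n. h n / (real (Suc n) * (real (Suc n) + a)))"
  have L: "((\<lambda>n. (h n ^ 3 - 3 * h n * z n) * u n ^ s) has_sum L) UNIV"
    unfolding L_def by (intro has_sum_weighted s cube_bound)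
  have Q: "((\<lambda>n. (h n)\<^sup>2 * u n ^ (s + 1)) has_sum Q) UNIV"
    unfolding Q_def by (intro has_sum_weighted square_bound) (use s in simp)
  have S: "((\<lambda>n. h n * u n ^ p) has_sum S p) UNIV" if "p \<ge> 2" for p
    unfolding S_def by (intro has_sum_weighted that linear_bound)
  have summable_B: "summable (\<lambda>n. h n / (real (Suc n) * (real (Suc n) + a)))"
  proof (rule summable_comparison_test')
    show "summable (\<lambda>n. K * (h n ^ 3 / (real (Suc n))\<^sup>2))"
      unfolding h_def by (intro summable_mult summable_harm_cube_over_square)
    fix n
    have "h n / real (Suc n) * \<bar>u n\<bar> \<le> h n ^ 3 / real (Suc n) * (K / real (Suc n))"
      using h_cube[of 1 n] h_ge_1[of n] K by (intro mult_mono divide_right_mono) auto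
    thus "norm (h n / (real (Suc n) * (real (Suc n) + a))) \<le> K * (h n ^ 3 / (real (Suc n))\<^sup>2)"
      using h_ge_1[of n] by (simp add: abs_mult u_def power2_eq_square mult_ac)
  qed

  \<comment> \<open>\<open>F n n = 0\<close>, since \<open>x / 0 = 0\<close>\<close>
  define F where "F n m = h n * h m * u n ^ (s - 1) * u m / (real m - real n)" for n m
  have "(\<lambda>(n, m). F n m) summable_on UNIV \<times> UNIV"
  proof -
    let ?w = "\<lambda>(n, m). h n * h m / (real (Suc n) * real (Suc m) * \<bar>real m - real n\<bar>)"
    have "(\<lambda>p. norm ((\<lambda>(n, m). F n m) p)) summable_on (UNIV \<times> UNIV)"
    proof (rule Infinite_Sum.abs_summable_on_comparison_test')
      show "(\<lambda>p. K ^ s * ?w p) summable_on UNIV \<times> UNIV"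
        unfolding h_def using summable_on_harm_product_kernel by (intro summable_on_cmult_right) simp
      show "norm ((\<lambda>(n, m). F n m) p) \<le> K ^ s * ?w p" for p
      proof (cases p)
        case (Pair n m)
        \<comment> \<open>Only one factor \<open>1 / real (Suc n)\<close> of the decay of
          \<open>u n ^ (s - 1)\<close> is kept, so \<open>s = 2\<close> is covered as well.\<close>
        have "\<bar>u n\<bar> ^ (s - 1) * \<bar>u m\<bar> \<le> (K ^ (s - 1) / real (Suc n)) * (K / real (Suc m))"
          using u_power_le[of 1 "s - 1" n] K s by (intro mult_mono) auto
        also have "\<dots> = K ^ s / (real (Suc n) * real (Suc m))"
          using s by (cases s) auto
        finally have "h n * h m / \<bar>real m - real n\<bar> * (\<bar>u n\<bar> ^ (s - 1) * \<bar>u m\<bar>) \<le>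
            h n * h m / \<bar>real m - real n\<bar> * (K ^ s / (real (Suc n) * real (Suc m)))"
          using h_ge_1[of n] h_ge_1[of m] by (intro mult_left_mono) auto
        thus ?thesis
          using h_ge_1[of n] h_ge_1[of m]
          by (simp add: Pair F_def abs_mult power_abs mult_ac del: of_nat_Suc)
      qed
    qed
    thus ?thesis
      by (subst summable_on_iff_abs_summable_on_real) simp
  qed
  then obtain X where F: "((\<lambda>(n, m). F n m) has_sum X) (UNIV \<times> UNIV)"
    by (auto simp: summable_on_def)

  \<comment> \<open>On the diagonal the left side is 0 while the sum has \<open>s - 2\<close> equal
    terms, whence the correction \<open>2 - real s\<close>.\<close>
  have F_symmetrised: "F n m + F m n = (\<Sum>j=2..s-1. h n * u n ^ j * (h m * u m ^ (s + 1 - j)))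
      + (if n = m then (2 - real s) * ((h n)\<^sup>2 * u n ^ (s + 1)) else 0)" for n m
  proof (cases "n = m")
    case True
    have "(\<Sum>j=2..s-1. h n * u n ^ j * (h n * u n ^ (s + 1 - j))) =
        (\<Sum>j=2..s-1. (h n)\<^sup>2 * u n ^ (s + 1))"
    proof (intro sum.cong refl)
      fix j assume "j \<in> {2..s-1}"
      hence "s + 1 = j + (s + 1 - j)" by auto
      hence "u n ^ (s + 1) = u n ^ j * u n ^ (s + 1 - j)"
        by (metis power_add)
      thus "h n * u n ^ j * (h n * u n ^ (s + 1 - j)) = (h n)\<^sup>2 * u n ^ (s + 1)"
        by (simp only: power2_eq_square mult_ac)
    qed
    thus ?thesis
      using True s by (simp add: F_def of_nat_diff algebra_simps)
  next
    case False
    obtain r where r: "s = Suc (Suc r)"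
      using s by (metis add_2_eq_Suc le_Suc_ex)
    have nm: "real m - real n \<noteq> 0" "real n - real m \<noteq> 0"
      using False by auto
    define G where "G = (\<Sum>j=2..Suc r. u n ^ j * u m ^ (r + 3 - j))"
    \<comment> \<open>This turns the factor \<open>x - y\<close> of the geometric identity into the
      denominator of \<open>F\<close>, at the price of a factor \<open>u n * u m\<close> that is
      nonzero and cancels.\<close>
    have "u n - u m = (real m - real n) * (u n * u m)"
      using shift_nz[of n] shift_nz[of m] by (simp add: u_def divide_simps)
    hence "(u n * u m) * ((real m - real n) * G) = (u n * u m) * (u n * u m * (u n ^ r - u m ^ r))"
      using sum_geometric_mixed[of "u n" "u m" r, folded G_def] by (simp add: power2_eq_square mult_ac)
    hence "(real m - real n) * G = u n * u m * (u n ^ r - u m ^ r)"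
      using u_nz[of n] u_nz[of m] by simp
    hence "G = (u n ^ Suc r * u m - u m ^ Suc r * u n) / (real m - real n)"
      using nm by (simp add: eq_divide_eq algebra_simps)
    moreover have "F m n = - (h n * h m * (u m ^ Suc r * u n) / (real m - real n))"
      unfolding F_def r minus_divide_right by (simp add: mult_ac)
    ultimately have "h n * h m * G = F n m + F m n"
      by (simp add: F_def r diff_divide_distrib right_diff_distrib mult_ac)
    moreover have "h n * h m * G = (\<Sum>j=2..s-1. h n * u n ^ j * (h m * u m ^ (s + 1 - j)))"
      unfolding G_def sum_distrib_left r by (intro sum.cong) (auto simp: mult_ac numeral_3_eq_3)
    ultimately show ?thesis
      using False by simp
  qed

  have "((\<lambda>(n, m). F m n) has_sum X) (UNIV \<times> UNIV)"
    using has_sum_swap[THEN iffD1, OF F] by simp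
  \<comment> \<open>Swapping the variables keeps the total, so the symmetrised series has sum
    \<open>X + X\<close>; it is then evaluated through products of single series.\<close>
  hence "((\<lambda>p. (\<lambda>(n, m). F n m) p + (\<lambda>(n, m). F m n) p) has_sum (X + X)) (UNIV \<times> UNIV)"
    by (rule has_sum_add[OF F])
  moreover have "((\<lambda>p. (\<lambda>(n, m). F n m) p + (\<lambda>(n, m). F m n) p) has_sum
      ((\<Sum>j=2..s-1. S j * S (s + 1 - j)) + (2 - real s) * Q)) (UNIV \<times> UNIV)"
  proof -
    have "((\<lambda>p. (\<Sum>j=2..s-1. (\<lambda>(n, m). h n * u n ^ j * (h m * u m ^ (s + 1 - j))) p)
          + (\<lambda>(n, m). if n = m then (2 - real s) * ((h n)\<^sup>2 * u n ^ (s + 1)) else 0) p) has_sum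
        ((\<Sum>j=2..s-1. S j * S (s + 1 - j)) + (2 - real s) * Q)) (UNIV \<times> UNIV)"
      by (intro has_sum_add has_sum_sum has_sum_times has_sum_diagonal has_sum_cmult_right S Q) auto
    thus ?thesis
      by (simp add: case_prod_unfold F_symmetrised)
  qed
  ultimately have XX: "X + X = (\<Sum>j=2..s-1. S j * S (s + 1 - j)) + (2 - real s) * Q"
    by (rule has_sum_unique)

  have inner: "(F n has_sum (h n * u n ^ s * ((3 * z n - (h n)\<^sup>2) / 2 + a * B + h n * u n))) UNIV" for n
  proof -
    \<comment> \<open>At \<open>m = n\<close> the first two summands leave
      \<open>- h n * u n\<close>, whereas \<open>F n n = 0\<close>; the last summand
      compensates.\<close>
    let ?k = "\<lambda>m. h m * (1 / (real m - real n) - 1 / real (Suc m))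
        + a * (h m / (real (Suc m) * (real (Suc m) + a))) + (if m = n then h n * u n else 0)"
    have "(\<lambda>m. h n * u n ^ s * ?k m) sums
        (h n * u n ^ s * ((3 * z n - (h n)\<^sup>2) / 2 + a * B + h n * u n))"
      unfolding B_def
      by (intro sums_mult sums_add summable_sums summable_B sums_single
            sums_harm_kernel[of n, folded h_def z_def])
    also have "(\<lambda>m. h n * u n ^ s * ?k m) = F n"
    proof
      fix m
      have "h m * (a / (real (Suc m) * (real (Suc m) + a))) = h m * (1 / real (Suc m) - u m)"
        using shift_nz[of m] by (simp add: u_def divide_simps)
      hence k: "?k m = h m * (1 / (real m - real n) - u m) + (if m = n then h n * u n else 0)"
        by (simp add: algebra_simps del: of_nat_Suc)
      have "u n * ?k m = h m * u m / (real m - real n)"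
      proof (cases "m = n")
        case False
        \<comment> \<open>The difference of the denominators \<open>m + 1 + a\<close> and
          \<open>m - n\<close> is \<open>n + 1 + a\<close>, which the factor \<open>u n\<close>
          cancels.\<close>
        hence "u n * (1 / (real m - real n) - u m) = u m / (real m - real n)"
          using shift_nz[of m] shift_nz[of n] by (simp add: u_def divide_simps)
        with False show ?thesis
          unfolding k by (simp add: mult.left_commute[of "u n" "h m"] del: of_nat_Suc)
      next
        case True
        thus ?thesis
          unfolding k by simp
      qed
      hence "h n * u n ^ (s - 1) * (u n * ?k m) = F n m"
        by (simp add: F_def mult_ac)
      moreover have "u n ^ s = u n ^ (s - 1) * u n"
        using s by (cases s) auto
      ultimately show "h n * u n ^ s * ?k m = F n m"
        by (simp only: mult.assoc)
    qed
    finally have "F n sums (h n * u n ^ s * ((3 * z n - (h n)\<^sup>2) / 2 + a * B + h n * u n))" .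
    \<comment> \<open>The kernel formula evaluates only an ordinary series. Each row is
      unconditionally summable as a slice of \<open>F\<close>, and uniqueness of limits carries the
      value over.\<close>
    moreover have "(F n has_sum infsum (F n) UNIV) UNIV"
      by (intro has_sum_infsum summable_on_SigmaD1[OF has_sum_imp_summable[OF F]]) simp
    moreover from this have "F n sums infsum (F n) UNIV"
      by (rule has_sum_imp_sums)
    ultimately show ?thesis
      by (metis sums_unique2)
  qed
  have "((\<lambda>n. h n * u n ^ s * ((3 * z n - (h n)\<^sup>2) / 2 + a * B + h n * u n)) has_sum X) UNIV"
    by (rule has_sum_SigmaD[OF F]) (simp add: inner)
  moreover have "((\<lambda>n. h n * u n ^ s * ((3 * z n - (h n)\<^sup>2) / 2 + a * B + h n * u n)) has_sum
      ((- 1 / 2) * L + a * B * S s + Q)) UNIV"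
  proof -
    have "h n * u n ^ s * ((3 * z n - (h n)\<^sup>2) / 2 + a * B + h n * u n) =
        (- 1 / 2) * ((h n ^ 3 - 3 * h n * z n) * u n ^ s) + a * B * (h n * u n ^ s)
          + (h n)\<^sup>2 * u n ^ (s + 1)" for n
      by (simp add: field_simps power2_eq_square power3_eq_cube)
    moreover have "((\<lambda>n. (- 1 / 2) * ((h n ^ 3 - 3 * h n * z n) * u n ^ s) + a * B * (h n * u n ^ s)
        + (h n)\<^sup>2 * u n ^ (s + 1)) has_sum ((- 1 / 2) * L + a * B * S s + Q)) UNIV"
      by (intro has_sum_add has_sum_cmult_right L S Q s)
    ultimately show ?thesis
      by (simp only:)
  qed
  ultimately have "X = (- 1 / 2) * L + a * B * S s + Q"
    by (rule has_sum_unique)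
  \<comment> \<open>Doubling the row-wise value of \<open>X\<close> gives \<open>2 * Q\<close>,
    which against \<open>(2 - real s) * Q\<close> leaves \<open>real s * Q\<close>.\<close>
  with XX have "L = real s * Q - (\<Sum>j=2..s-1. S j * S (s + 1 - j)) + 2 * a * S s * B"
    by (simp add: algebra_simps)
  moreover have "summable (\<lambda>n. h n * u n ^ j)" if "j \<in> {2..s}" for j
    using that by (intro summable_on_imp_summable has_sum_imp_summable[OF S]) simp
  ultimately show ?thesis
    using summable_on_imp_summable[OF has_sum_imp_summable[OF L]]
      summable_on_imp_summable[OF has_sum_imp_summable[OF Q]] summable_B
    unfolding div_u h_def[symmetric] z_def[symmetric]
      L_def[symmetric] Q_def[symmetric] S_def[symmetric] B_def[symmetric]
    by blast
qed

end
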